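(* Let $\nu$ be a complex number that is not a negative integer, and let $D_{n,\nu}(q) = \prod_{k=1}^n [k+\nu]_q^{\lfloor n/k \rfloor}$. Then there exist polynomials $N^{(1)}_{n,\nu}(q)$, $n\ge1$, in $q$, $q^\nu$ and $[\nu]_q$ with nonnegative integer coefficients such that, as formal power series in $z$, both \[ \frac{J^{(1)}_{\nu+1}((1-q)z;q)}{J^{(1)}_\nu((1-q)z;q)} = \sum_{n=1}^{\infty} \frac{N^{(1)}_{n,\nu}(q)}{D_{n,\nu}(q)} q^{(\nu+1)(n-1)} \left( \frac{z}{2}\right)^{2n-1} \] and \[ \frac{J^{(1)}_{\nu+1}((1-q)z;q^{-1})}{J^{(1)}_\nu((1-q)z;q^{-1})} = - \sum_{n=1}^{\infty} \frac{N^{(1)}_{n,\nu}(q)}{D_{n,\nu}(q)} q^{(\nu+2) n - 1} \left( \frac{z}{2}\right)^{2n-1} \] hold.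
   Context: Notation: $(a;p)_n=(1-a)(1-ap)\cdots(1-ap^{n-1})$, $(a;p)_\infty=\prod_{i\ge0}(1-ap^i)$, $[x]_q=(1-q^x)/(1-q)$. Jackson's $q$-Bessel function with base $p$ is $J^{(1)}_\nu(w;p)=\frac{(p^{\nu+1};p)_\infty}{(p;p)_\infty}(w/2)^\nu\Psi_\nu(w;p)$, where $\Psi_\nu(w;p)=\sum_{n\ge0}\frac{(-w^2/4)^n}{(p;p)_n(p^{\nu+1};p)_n}$. Thus $\frac{J^{(1)}_{\nu+1}(w;p)}{J^{(1)}_\nu(w;p)}=\frac{w/2}{1-p^{\nu+1}}\frac{\Psi_{\nu+1}(w;p)}{\Psi_\nu(w;p)}$; for base $p=q^{-1}$ this is understood as a formal power series in $w$ with coefficients rational in $q$ and $q^\nu$. *)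

theory Defs
  imports "HOL-Complex_Analysis.Complex_Analysis" "HOL-Library.Poly_Mapping"
begin

text \<open>
  The base is given by one of its logarithms: \<open>l\<close> stands for the base \<open>p = exp l\<close>, and all powers
  \<open>p\<^sup>s\<close> are taken with respect to this branch.  The base \<open>p\<^sup>-\<^sup>1\<close> is then given by \<open>- l\<close>, and
  \<open>(p\<^sup>-\<^sup>1)\<^sup>s = p\<^sup>-\<^sup>s\<close> holds without exception; with the principal branch \<open>powr\<close> this would fail for
  negative real \<open>p\<close>.
\<close>

definition base_pow :: "complex \<Rightarrow> complex \<Rightarrow> complex" where
  "base_pow l s = exp (s * l)"

lemma base_pow_Ln: "q \<noteq> 0 \<Longrightarrow> base_pow (Ln q) s = q powr s"
  by (simp add: base_pow_def powr_def)

lemma base_pow_of_nat: "base_pow l (of_nat k) = exp l ^ k"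
  by (simp add: base_pow_def exp_of_nat_mult)

lemma base_pow_add: "base_pow l (s + t) = base_pow l s * base_pow l t"
  by (simp add: base_pow_def exp_add ring_distribs)

definition q_bracket :: "complex \<Rightarrow> complex \<Rightarrow> complex" where
  "q_bracket l x = (1 - base_pow l x) / (1 - exp l)"

definition q_poch :: "complex \<Rightarrow> complex \<Rightarrow> nat \<Rightarrow> complex" where
  "q_poch a p n = (\<Prod>i<n. 1 - a * p ^ i)"

definition q_poch_inf :: "complex \<Rightarrow> complex \<Rightarrow> complex" where
  "q_poch_inf a p = prodinf (\<lambda>i. 1 - a * p ^ i)"

definition jackson_Psi_coeff :: "complex \<Rightarrow> complex \<Rightarrow> nat \<Rightarrow> complex" where
  "jackson_Psi_coeff \<nu> l n =
     1 / (q_poch (exp l) (exp l) n * q_poch (base_pow l (\<nu> + 1)) (exp l) n)"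

definition jackson_Psi :: "complex \<Rightarrow> complex \<Rightarrow> complex fps" where
  "jackson_Psi \<nu> l = Abs_fps (jackson_Psi_coeff \<nu> l) oo (- (fps_X ^ 2) / 4)"

text \<open>
  The quotient of Jackson's \<open>q\<close>-Bessel functions of orders \<open>\<nu> + 1\<close> and \<open>\<nu>\<close>, as a formal power series
  in \<open>w\<close>.  The infinite products and the factors \<open>(w/2)\<^sup>\<nu>\<close> cancel except for \<open>(w/2) / (1 - p\<^sup>\<nu>\<^sup>+\<^sup>1)\<close>;
  this makes sense for any base that is not a root of unity with no \<open>p\<^sup>\<nu>\<^sup>+\<^sup>k\<close> (\<open>k \<ge> 1\<close>) equal to 1.
  See \<open>jackson_J1_quotient_has_fps_expansion\<close> below for the case \<open>|p| < 1\<close>.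
\<close>

definition jackson_J1_quotient :: "complex \<Rightarrow> complex \<Rightarrow> complex fps" where
  "jackson_J1_quotient \<nu> l =
     fps_const (1 / (1 - base_pow l (\<nu> + 1))) * (fps_X / 2) *
       (jackson_Psi (\<nu> + 1) l / jackson_Psi \<nu> l)"

definition D_den :: "nat \<Rightarrow> complex \<Rightarrow> complex \<Rightarrow> complex" where
  "D_den n \<nu> l = (\<Prod>k=1..n. q_bracket l (of_nat k + \<nu>) ^ (n div k))"

text \<open>
  A polynomial in three variables with nonnegative integer coefficients is a finitely supported
  function from exponent triples to \<open>nat\<close>.
\<close>

definition eval_poly3 :: "(nat \<times> nat \<times> nat \<Rightarrow>\<^sub>0 nat) \<Rightarrow> complex \<Rightarrow> complex \<Rightarrow> complex \<Rightarrow> complex" where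
  "eval_poly3 P x y z =
     (\<Sum>(a, b, c)\<in>Poly_Mapping.keys P. of_nat (Poly_Mapping.lookup P (a, b, c)) * x ^ a * y ^ b * z ^ c)"

text \<open>Jackson's function itself, whose infinite products require \<open>|p| < 1\<close>.\<close>

definition jackson_J1 :: "complex \<Rightarrow> complex \<Rightarrow> complex \<Rightarrow> complex" where
  "jackson_J1 \<nu> l w =
     q_poch_inf (base_pow l (\<nu> + 1)) (exp l) / q_poch_inf (exp l) (exp l) * (w / 2) powr \<nu> *
       suminf (\<lambda>n. jackson_Psi_coeff \<nu> l n * (- (w ^ 2) / 4) ^ n)"

lemma convergent_q_poch:
  assumes "norm p < 1"
  shows "convergent_prod (\<lambda>i. 1 - a * p ^ i :: complex)"
proof -
  have "summable (\<lambda>i. norm (- (a * p ^ i)))"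
    using assms by (simp add: norm_mult norm_power summable_mult summable_geometric)
  then have "convergent_prod (\<lambda>i. 1 + (- (a * p ^ i)))"
    by (intro abs_convergent_prod_imp_convergent_prod)
       (simp add: abs_convergent_prod_conv_summable)
  then show ?thesis by simp
qed

lemma q_poch_inf_nonzero:
  assumes "norm p < 1" "\<And>i. a * p ^ i \<noteq> 1"
  shows "q_poch_inf a p \<noteq> 0"
  unfolding q_poch_inf_def
  using assms by (intro prodinf_nonzero convergent_q_poch) auto

lemma q_poch_tendsto:
  assumes "norm p < 1"
  shows "q_poch a p \<longlonglongrightarrow> q_poch_inf a p"
  using convergent_prod_LIMSEQ[OF convergent_q_poch[OF assms, of a]]
  unfolding q_poch_def[abs_def] q_poch_inf_def by (simp add: LIMSEQ_lessThan_iff_atMost)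

lemma base_power_neq_1:
  fixes p :: complex
  assumes "norm p < 1"
  shows "p * p ^ i \<noteq> 1"
proof
  assume "p * p ^ i = 1"
  then have "norm p ^ Suc i = 1" by (metis norm_one norm_power power_Suc)
  moreover have "norm p ^ Suc i < 1" using assms
    by (metis norm_ge_zero power_less_one_iff zero_less_Suc)
  ultimately show False by simp
qed

lemma jackson_Psi_has_fps_expansion:
  assumes p: "norm (exp l) < 1"
    and \<nu>: "\<And>k::nat. k \<ge> 1 \<Longrightarrow> base_pow l (\<nu> + of_nat k) \<noteq> 1"
  shows "(\<lambda>w. suminf (\<lambda>n. jackson_Psi_coeff \<nu> l n * (- (w ^ 2) / 4) ^ n)) has_fps_expansion jackson_Psi \<nu> l"
proof -
  let ?c = "jackson_Psi_coeff \<nu> l"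
  note n1 = base_power_neq_1[OF p]
  have n2: "base_pow l (\<nu> + 1) * exp l ^ i \<noteq> 1" for i
    using \<nu>[of "Suc i"] by (simp add: base_pow_of_nat[symmetric] base_pow_add[symmetric] add_ac)
  have "?c \<longlonglongrightarrow> 1 / (q_poch_inf (exp l) (exp l) * q_poch_inf (base_pow l (\<nu> + 1)) (exp l))"
    unfolding jackson_Psi_coeff_def[abs_def]
    by (intro tendsto_intros q_poch_tendsto p)
       (use q_poch_inf_nonzero[OF p n1] q_poch_inf_nonzero[OF p n2] in simp)
  then have "Bseq ?c" by (meson Bseq_eq_bounded convergentI convergent_imp_Bseq)
  then obtain K where K: "K > 0" "\<And>n. norm (?c n) \<le> K" by (auto simp: Bseq_def)
  have "conv_radius ?c \<ge> ereal (norm (1 / 2 :: complex))"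
  proof (rule conv_radius_geI)
    have "summable (\<lambda>n. K * (1 / 2) ^ n :: real)" by (intro summable_mult summable_geometric) auto
    then show "summable (\<lambda>n. ?c n * (1 / 2 :: complex) ^ n)"
      by (rule summable_comparison_test'[where N = 0])
         (auto simp: norm_mult norm_power power_divide norm_divide intro!: divide_right_mono K)
  qed
  then have "fps_conv_radius (Abs_fps ?c) \<ge> ereal (norm (1 / 2 :: complex))"
    by (simp add: fps_conv_radius_def fps_nth_Abs_fps[abs_def] Abs_fps_inverse)
  then have "fps_conv_radius (Abs_fps ?c) > 0"
    by (rule less_le_trans[rotated]) simp
  hence "eval_fps (Abs_fps ?c) has_fps_expansion Abs_fps ?c"
    by (rule eval_fps_has_fps_expansion)
  moreover have "(\<lambda>w::complex. - (w ^ 2) / 4) has_fps_expansion (- (fps_X ^ 2) / 4)"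
    by (intro fps_expansion_intros) auto
  ultimately have "(eval_fps (Abs_fps ?c) \<circ> (\<lambda>w. - (w ^ 2) / 4)) has_fps_expansion
      (Abs_fps ?c oo (- (fps_X ^ 2) / 4))"
    by (rule has_fps_expansion_compose) (simp add: fps_divide_unit)
  then show ?thesis by (simp add: jackson_Psi_def eval_fps_def o_def)
qed

text \<open>At \<open>w = 0\<close> the quotient of values is \<open>0 / 0 = 0\<close>, the constant term of the series.\<close>

lemma jackson_J1_quotient_has_fps_expansion:
  assumes p: "norm (exp l) < 1"
    and \<nu>: "\<And>k::nat. k \<ge> 1 \<Longrightarrow> base_pow l (\<nu> + of_nat k) \<noteq> 1"
  shows "(\<lambda>w. jackson_J1 (\<nu> + 1) l w / jackson_J1 \<nu> l w) has_fps_expansion jackson_J1_quotient \<nu> l"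
proof -
  let ?P = "\<lambda>\<nu> w. suminf (\<lambda>n. jackson_Psi_coeff \<nu> l n * (- (w ^ 2) / 4) ^ n)"
  let ?a = "base_pow l (\<nu> + 1)"
  have \<nu>': "base_pow l (\<nu> + 1 + of_nat k) \<noteq> 1" if "k \<ge> 1" for k
    using \<nu>[of "Suc k"] by (simp add: add_ac)
  note n1 = base_power_neq_1[OF p]
  have n2: "?a * exp l ^ i \<noteq> 1" for i
    using \<nu>[of "Suc i"] by (simp add: base_pow_of_nat[symmetric] base_pow_add[symmetric] add_ac)
  have nz: "q_poch_inf (exp l) (exp l) \<noteq> 0" "q_poch_inf ?a (exp l) \<noteq> 0"
    using q_poch_inf_nonzero[OF p n1] q_poch_inf_nonzero[OF p n2] by blast+
  have a2: "base_pow l (\<nu> + 1 + 1) = ?a * exp l"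
    using base_pow_add[of l "\<nu> + 1" 1] base_pow_of_nat[of l 1] by simp
  have split: "q_poch_inf ?a (exp l) = (1 - ?a) * q_poch_inf (base_pow l (\<nu> + 1 + 1)) (exp l)"
  proof -
    have "1 - ?a * exp l ^ i \<noteq> 0" for i using n2[of i] by simp
    from prodinf_split_head[OF convergent_q_poch[OF p, of ?a] this] n2[of 0]
    show ?thesis unfolding q_poch_inf_def a2 by (simp add: mult.assoc)
  qed
  have "(\<lambda>w. 1 / (1 - ?a) * (w / 2) * (?P (\<nu> + 1) w / ?P \<nu> w)) has_fps_expansion
      jackson_J1_quotient \<nu> l"
    unfolding jackson_J1_quotient_def
    by (intro fps_expansion_intros jackson_Psi_has_fps_expansion p \<nu> \<nu>')
       (simp_all add: jackson_Psi_def jackson_Psi_coeff_def q_poch_def)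
  moreover have "jackson_J1 (\<nu> + 1) l w / jackson_J1 \<nu> l w =
      1 / (1 - ?a) * (w / 2) * (?P (\<nu> + 1) w / ?P \<nu> w)" for w
  proof (cases "w = 0")
    case False
    then have w: "(w / 2) powr (\<nu> + 1) = (w / 2) powr \<nu> * (w / 2)" "(w / 2) powr \<nu> \<noteq> 0"
      by (simp_all add: powr_add)
    have cancel: "(B / Z * (c * h) * S) / ((d * B) / Z * c * T) = 1 / d * h * (S / T)"
      if "Z \<noteq> 0" "d * B \<noteq> 0" "c \<noteq> 0" for B Z c h S T d :: complex
      using that by simp
    show ?thesis
      unfolding jackson_J1_def w(1) split
      by (rule cancel) (use nz w(2) split in simp_all)
  qed (simp add: jackson_J1_def)
  ultimately show ?thesis by simp
qed

end

theory Submission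
  imports Defs
begin

unbundle no vec_syntax

text \<open>
  Let \<open>b = p\<^sup>\<nu>\<^sup>+\<^sup>1\<close> and let \<open>H(y) = A\<^bsub>\<nu>+1\<^esub>(y) / ((1 - b) A\<^bsub>\<nu>\<^esub>(y))\<close>, where \<open>A\<^bsub>\<nu>\<^esub>\<close> is \<open>\<Psi>\<^bsub>\<nu>\<^esub>\<close> as a series in
  \<open>y = - w\<^sup>2 / 4\<close>.  The contiguous relations between \<open>A\<^bsub>\<nu>\<^esub>\<close> and \<open>A\<^bsub>\<nu>+1\<^esub>\<close> give the \<open>q\<close>-Riccati equation
  \<open>H(y) = 1 + b H(p y) (1 - y H(y))\<close>.  After rescaling the coefficients, the bases \<open>q\<close> and \<open>q\<^sup>-\<^sup>1\<close>
  both lead to the recurrence \<open>[n + \<nu>] S\<^sub>n = (\<Sum>i + j = n. q\<^bsup>i - 1\<^esup> S\<^sub>i S\<^sub>j)\<close> with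
  \<open>[1 + \<nu>] S\<^sub>1 = 1\<close>.  Since \<open>\<lfloor>n/k\<rfloor> \<ge> \<lfloor>i/k\<rfloor> + \<lfloor>j/k\<rfloor>\<close> for \<open>i + j = n\<close>, strictly for \<open>k = n\<close>, the product
  \<open>[n + \<nu>] D\<^sub>i D\<^sub>j\<close> divides \<open>D\<^sub>n\<close>; hence \<open>N\<^sub>n = D\<^sub>n S\<^sub>n\<close> satisfies a recurrence with nonnegative
  coefficients, because \<open>[k + \<nu>] = 1 + q + \<dots> + q\<^bsup>k - 1\<^esup> + q\<^sup>k [\<nu>]\<close>.
\<close>

section \<open>Polynomial functions with nonnegative integer coefficients\<close>

text \<open>A predicate on functions lets the numerators be defined by recursion as functions; a
  polynomial is extracted only at the end. Quantifying over all arguments makes it the same for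
  every base.\<close>

definition natpoly3 :: "(complex \<Rightarrow> complex \<Rightarrow> complex \<Rightarrow> complex) \<Rightarrow> bool" where
  "natpoly3 F \<longleftrightarrow> (\<exists>P. \<forall>x y z. eval_poly3 P x y z = F x y z)"

lemma eval_poly3_superset:
  assumes "finite S" "Poly_Mapping.keys P \<subseteq> S"
  shows "eval_poly3 P x y z =
    (\<Sum>(a, b, c)\<in>S. of_nat (Poly_Mapping.lookup P (a, b, c)) * x ^ a * y ^ b * z ^ c)"
  unfolding eval_poly3_def using assms
  by (intro sum.mono_neutral_left) (auto simp: in_keys_iff)

lemma eval_poly3_add: "eval_poly3 (P + Q) x y z = eval_poly3 P x y z + eval_poly3 Q x y z"
proof -
  let ?S = "Poly_Mapping.keys P \<union> Poly_Mapping.keys Q"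
  have "finite ?S" by simp
  note * = eval_poly3_superset[OF this]
  show ?thesis
    by (subst (1 2 3) *)
       (auto simp: lookup_add Poly_Mapping.keys_add case_prod_unfold ring_distribs sum.distrib
             dest: subsetD[OF Poly_Mapping.keys_add])
qed

lemma natpoly3_monom: "natpoly3 (\<lambda>x y z. of_nat k * x ^ a * y ^ b * z ^ c)"
  unfolding natpoly3_def
  by (rule exI[of _ "Poly_Mapping.single (a, b, c) k"]) (auto simp: eval_poly3_def)

lemma natpoly3_const: "natpoly3 (\<lambda>x y z. of_nat k)"
  using natpoly3_monom[of k 0 0 0] by simp

lemma natpoly3_add:
  assumes "natpoly3 F" "natpoly3 G"
  shows "natpoly3 (\<lambda>x y z. F x y z + G x y z)"
  using assms unfolding natpoly3_def by (metis eval_poly3_add)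

lemma natpoly3_sum:
  assumes "\<And>i. i \<in> I \<Longrightarrow> natpoly3 (F i)"
  shows "natpoly3 (\<lambda>x y z. \<Sum>i\<in>I. F i x y z)"
  using assms
proof (induction I rule: infinite_finite_induct)
  case (insert i I)
  then show ?case by (simp add: natpoly3_add)
qed (use natpoly3_const[of 0] in simp_all)

lemma natpoly3_mult:
  assumes "natpoly3 F" "natpoly3 G"
  shows "natpoly3 (\<lambda>x y z. F x y z * G x y z)"
proof -
  obtain P Q where F: "F = eval_poly3 P" and G: "G = eval_poly3 Q"
    using assms unfolding natpoly3_def by (metis ext)
  \<comment> \<open>Expanding into a double sum of monomials reduces the product to closure under
    sums, so no product of \<open>P\<close> and \<open>Q\<close> has to be formed.\<close>
  let ?t = "\<lambda>s t x y z. of_nat (Poly_Mapping.lookup P s * Poly_Mapping.lookup Q t) *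
      x ^ (fst s + fst t) * y ^ (fst (snd s) + fst (snd t)) * z ^ (snd (snd s) + snd (snd t))"
  have "(\<lambda>x y z. F x y z * G x y z) =
      (\<lambda>x y z. \<Sum>s\<in>Poly_Mapping.keys P. \<Sum>t\<in>Poly_Mapping.keys Q. ?t s t x y z)"
    unfolding F G eval_poly3_def sum_product
    by (simp add: case_prod_unfold power_add mult_ac)
  then show ?thesis by (simp only:) (intro natpoly3_sum natpoly3_monom)
qed

lemma natpoly3_power: "natpoly3 F \<Longrightarrow> natpoly3 (\<lambda>x y z. F x y z ^ n)"
  by (induction n) (use natpoly3_const[of 1] in \<open>auto intro: natpoly3_mult\<close>)

lemma natpoly3_prod:
  assumes "\<And>i. i \<in> I \<Longrightarrow> natpoly3 (F i)"
  shows "natpoly3 (\<lambda>x y z. \<Prod>i\<in>I. F i x y z)"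
  using assms
proof (induction I rule: infinite_finite_induct)
  case (insert i I)
  then show ?case by (simp add: natpoly3_mult)
qed (use natpoly3_const[of 1] in simp_all)

section \<open>The numerators\<close>

definition bracket_poly :: "nat \<Rightarrow> complex \<Rightarrow> complex \<Rightarrow> complex" where
  "bracket_poly k x z = (\<Sum>j<k. x ^ j) + x ^ k * z"

text \<open>For \<open>c k\<close> = [k + \<nu>] and positive i, j this is the cofactor D_(i+j) /
  ([i + j + \<nu>] D_i D_j). The range stops before i + j because the factor there, of exponent 1,
  is split off.\<close>

definition den_quot :: "(nat \<Rightarrow> complex) \<Rightarrow> nat \<Rightarrow> nat \<Rightarrow> complex" where
  "den_quot c i j = (\<Prod>k\<in>{1..<i + j}. c k ^ ((i + j) div k - i div k - j div k))"

lemma q_bracket_add_of_nat: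
  assumes "exp l \<noteq> 1"
  shows "q_bracket l (of_nat k + \<nu>) = bracket_poly k (exp l) (q_bracket l \<nu>)"
proof -
  have "(1 - exp l) * (\<Sum>j<k. exp l ^ j) = 1 - exp l ^ k" by (rule one_diff_power_eq[symmetric])
  then have "(\<Sum>j<k. exp l ^ j) = (1 - exp l ^ k) / (1 - exp l)"
    using assms by (simp add: field_simps)
  then show ?thesis
    by (simp add: bracket_poly_def q_bracket_def base_pow_add base_pow_of_nat
        add_divide_distrib[symmetric] algebra_simps)
qed

lemma prod_power_div_add:
  fixes c :: "nat \<Rightarrow> complex"
  assumes "i > 0" "j > 0"
  shows "(\<Prod>k=1..i + j. c k ^ ((i + j) div k)) =
    c (i + j) * (\<Prod>k=1..i. c k ^ (i div k)) * (\<Prod>k=1..j. c k ^ (j div k)) * den_quot c i j"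
proof -
  \<comment> \<open>For k > m the exponent \<open>m div k\<close> is 0, so all the products can
    share one index range.\<close>
  have ext: "(\<Prod>k=1..m. c k ^ (m div k)) = (\<Prod>k\<in>{1..<i + j}. c k ^ (m div k))" if "m < i + j" for m
    using that by (intro prod.mono_neutral_left) auto
  have "(\<Prod>k=1..i + j. c k ^ ((i + j) div k)) =
      c (i + j) * (\<Prod>k\<in>{1..<i + j}. c k ^ ((i + j) div k))"
  proof -
    have "{1..i + j} = insert (i + j) {1..<i + j}" using assms by auto
    then show ?thesis using assms by simp
  qed
  also have "(\<Prod>k\<in>{1..<i + j}. c k ^ ((i + j) div k)) =
      (\<Prod>k\<in>{1..<i + j}. c k ^ (i div k) * c k ^ (j div k) *
        c k ^ ((i + j) div k - i div k - j div k))"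
  proof (intro prod.cong refl)
    fix k
    \<comment> \<open>Superadditivity of the floor makes the truncated subtraction exact.\<close>
    have "i div k + j div k \<le> (i + j) div k" by (metis div_add1_eq le_add1)
    then have "(i + j) div k = i div k + j div k + ((i + j) div k - i div k - j div k)" by simp
    then show "c k ^ ((i + j) div k) = c k ^ (i div k) * c k ^ (j div k) *
        c k ^ ((i + j) div k - i div k - j div k)"
      by (metis power_add)
  qed
  finally show ?thesis
    using ext[of i] ext[of j] assms by (simp add: prod.distrib den_quot_def mult_ac)
qed

text \<open>Indices are shifted: \<open>numerator m\<close> is \<open>N\<^bsub>m+1\<^esub>\<close>, in the variables \<open>x = q\<close> and \<open>z = [\<nu>]\<close>.\<close>

fun numerator :: "nat \<Rightarrow> complex \<Rightarrow> complex \<Rightarrow> complex" where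
  "numerator 0 x z = 1"
| "numerator (Suc m) x z = (\<Sum>i\<le>m. x ^ i * den_quot (\<lambda>k. bracket_poly k x z) (Suc i) (Suc (m - i)) *
     numerator i x z * numerator (m - i) x z)"

lemma natpoly3_bracket_poly: "natpoly3 (\<lambda>x y z. bracket_poly k x z)"
proof -
  have "natpoly3 (\<lambda>x y z. x ^ j)" "natpoly3 (\<lambda>x y z. x ^ k * z)" for j
    using natpoly3_monom[of 1 j 0 0] natpoly3_monom[of 1 k 0 1] by simp_all
  then show ?thesis
    unfolding bracket_poly_def by (intro natpoly3_add natpoly3_sum)
qed

lemma natpoly3_numerator: "natpoly3 (\<lambda>x y z. numerator m x z)"
proof (induction m rule: less_induct)
  case (less m)
  show ?case
  proof (cases m)
    case 0
    then show ?thesis using natpoly3_const[of 1] by simp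
  next
    case (Suc n)
    have "natpoly3 (\<lambda>x y z. x)"
      using natpoly3_monom[of 1 1 0 0] by simp
    then show ?thesis
      unfolding Suc numerator.simps den_quot_def
      by (intro natpoly3_sum natpoly3_mult natpoly3_prod natpoly3_power natpoly3_bracket_poly
          less.IH) (auto simp: Suc)
  qed
qed

text \<open>Indices are shifted here too: \<open>S m\<close> is S_(m+1), so the weight q^(i-1)
  becomes \<open>exp l ^ i\<close>. Multiplying the recurrence for \<open>S\<close> by the
  denominator gives that of \<open>numerator\<close>.\<close>

lemma numerator_eq_D_den_mult:
  assumes l: "exp l \<noteq> 1"
    and nz: "\<And>m. q_bracket l (of_nat (Suc m) + \<nu>) \<noteq> 0"
    and S0: "q_bracket l (1 + \<nu>) * S 0 = 1"
    and S: "\<And>m. q_bracket l (of_nat (m + 2) + \<nu>) * S (Suc m) =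
      (\<Sum>i\<le>m. exp l ^ i * S i * S (m - i))"
  shows "numerator m (exp l) (q_bracket l \<nu>) = D_den (Suc m) \<nu> l * S m"
proof (induction m rule: less_induct)
  case (less m)
  show ?case
  proof (cases m)
    case 0
    then show ?thesis using S0 by (simp add: D_den_def)
  next
    case (Suc n)
    let ?c = "\<lambda>k. q_bracket l (of_nat k + \<nu>)"
    have c: "?c = (\<lambda>k. bracket_poly k (exp l) (q_bracket l \<nu>))"
      using q_bracket_add_of_nat[OF l] by blast
    \<comment> \<open>Each i has its own factorisation of the same denominator, which can therefore
      be pulled out of the sum afterwards.\<close>
    have D: "D_den (Suc m) \<nu> l = ?c (n + 2) * D_den (Suc i) \<nu> l * D_den (Suc (n - i)) \<nu> l *
        den_quot ?c (Suc i) (Suc (n - i))" if "i \<le> n" for i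
      using prod_power_div_add[of "Suc i" "Suc (n - i)" ?c] that unfolding D_den_def
      by (simp add: Suc)
    have "numerator m (exp l) (q_bracket l \<nu>) = (\<Sum>i\<le>n. exp l ^ i *
        den_quot ?c (Suc i) (Suc (n - i)) *
        (D_den (Suc i) \<nu> l * S i) * (D_den (Suc (n - i)) \<nu> l * S (n - i)))"
      unfolding Suc numerator.simps c by (intro sum.cong refl) (simp add: less.IH Suc)
    also have "?c (n + 2) * \<dots> = (\<Sum>i\<le>n. D_den (Suc m) \<nu> l * (exp l ^ i * S i * S (n - i)))"
      unfolding sum_distrib_left by (intro sum.cong refl) (subst D, auto)
    also have "\<dots> = ?c (n + 2) * (D_den (Suc m) \<nu> l * S m)"
      unfolding sum_distrib_left[symmetric] S[symmetric] Suc by simp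
    finally have "?c (n + 2) * numerator m (exp l) (q_bracket l \<nu>) =
        ?c (n + 2) * (D_den (Suc m) \<nu> l * S m)" .
    moreover have "?c (n + 2) \<noteq> 0" using nz[of "Suc n"] by simp
    ultimately show ?thesis by (metis mult_left_cancel)
  qed
qed

section \<open>The recurrence for the coefficients of the quotient\<close>

lemma q_poch_Suc: "q_poch a p (Suc n) = q_poch a p n * (1 - a * p ^ n)"
  by (simp add: q_poch_def)

lemma q_poch_Suc_shift: "q_poch a p (Suc n) = (1 - a) * q_poch (a * p) p n"
  unfolding q_poch_def by (subst prod.lessThan_Suc_shift) (simp add: mult_ac)

text \<open>The series H, in the variable y = - w^2 / 4.\<close>

definition quot_fps :: "complex \<Rightarrow> complex \<Rightarrow> complex fps" where
  "quot_fps \<nu> l = fps_const (1 / (1 - base_pow l (\<nu> + 1))) *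
     (Abs_fps (jackson_Psi_coeff (\<nu> + 1) l) / Abs_fps (jackson_Psi_coeff \<nu> l))"

lemma quot_fps_riccati:
  fixes \<nu> l defines "p \<equiv> exp l" and "b \<equiv> base_pow l (\<nu> + 1)" and "H \<equiv> quot_fps \<nu> l"
  assumes p: "\<And>k. p ^ Suc k \<noteq> 1" and b: "\<And>k. b * p ^ k \<noteq> 1"
  shows "H = 1 + fps_const b * (H oo (fps_const p * fps_X)) * (1 - fps_X * H)"
proof -
  define A where "A = Abs_fps (jackson_Psi_coeff \<nu> l)"
  define G where "G = fps_const (1 / (1 - b)) * Abs_fps (jackson_Psi_coeff (\<nu> + 1) l)"
  let ?s = "\<lambda>F. F oo (fps_const p * fps_X)"
  have b': "base_pow l (\<nu> + 1 + 1) = b * p"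
    using base_pow_add[of l "\<nu> + 1" 1] base_pow_of_nat[of l 1] by (simp add: b_def p_def)
  have A_nth: "A $ n = 1 / (q_poch p p n * q_poch b p n)" for n
    by (simp add: A_def jackson_Psi_coeff_def p_def b_def)
  have G_nth: "G $ n = 1 / (q_poch p p n * q_poch b p (Suc n))" for n
    by (simp add: G_def jackson_Psi_coeff_def p_def[symmetric] b'[simplified] q_poch_Suc_shift)
  have nz: "q_poch p p n \<noteq> 0" "q_poch b p n \<noteq> 0" "1 - p * p ^ n \<noteq> 0" "1 - b * p ^ n \<noteq> 0" for n
    using p b by (auto simp: q_poch_def)
  have A0: "A $ 0 = 1" by (simp add: A_nth q_poch_def)
  \<comment> \<open>The factor 1 - b p^n cancels the last factor of (b;p)_(n+1).\<close>
  have r1: "A = G - fps_const b * ?s G"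
  proof (rule fps_ext)
    fix n
    show "A $ n = (G - fps_const b * ?s G) $ n"
      using nz[of n] by (simp add: A_nth G_nth q_poch_Suc) (simp add: divide_simps)
  qed
  \<comment> \<open>The factor 1 - p^n cancels the last factor of (p;p)_n for n > 0 and kills the
    constant term.\<close>
  have r2: "A - ?s A = fps_X * G"
  proof (rule fps_ext)
    fix n
    show "(A - ?s A) $ n = (fps_X * G) $ n"
    proof (cases n)
      case (Suc m)
      show ?thesis
        using nz(1,2)[of m] nz(3,4)[of m] unfolding Suc
        by (simp add: A_nth G_nth q_poch_Suc) (simp add: divide_simps)
    qed simp
  qed
  have H: "G = H * A"
  proof -
    \<comment> \<open>The quotient of series is exact because \<open>A\<close> has constant term
      1.\<close>
    have "A dvd Abs_fps (jackson_Psi_coeff (\<nu> + 1) l)" using A0 by (simp add: fps_is_unit_iff unit_imp_dvd)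
    then show ?thesis unfolding G_def H_def quot_fps_def A_def[symmetric] b_def by (simp add: mult.assoc)
  qed
  then have sG: "?s G = ?s H * ?s A" by (simp add: fps_compose_mult_distrib)
  have sA: "?s A = (1 - fps_X * H) * A" using r2 H by (simp add: algebra_simps)
  \<comment> \<open>By \<open>sG\<close> and \<open>sA\<close> every term of \<open>r1\<close> is
    now a multiple of \<open>A\<close>, which can be cancelled.\<close>
  have "H * A = A + fps_const b * ?s G" using r1 H by (simp add: algebra_simps)
  also have "\<dots> = (1 + fps_const b * ?s H * (1 - fps_X * H)) * A"
    unfolding sG sA by (simp add: algebra_simps)
  finally have "H * A = (1 + fps_const b * ?s H * (1 - fps_X * H)) * A" .
  moreover have "A \<noteq> 0" using A0 by auto
  ultimately show ?thesis by simp
qed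

lemma base_pow_mult_of_nat: "base_pow l (s * of_nat m) = base_pow l s ^ m"
  by (simp add: base_pow_def exp_of_nat_mult[symmetric] mult_ac)

text \<open>The sign comes from y = - (w/2)^2: this is the coefficient of (w/2)^(2m+1) in the Bessel
  quotient.\<close>

definition quot_coeff :: "complex \<Rightarrow> complex \<Rightarrow> nat \<Rightarrow> complex" where
  "quot_coeff \<nu> l m = (- 1) ^ m * quot_fps \<nu> l $ m"

text \<open>In the Riccati equation the linear term b H(py) moves to the left and yields the factor
  1 - b p^(m+1). The alternating sign in \<open>quot_coeff\<close> absorbs the minus sign of the
  quadratic term.\<close>

lemma quot_coeff_rec:
  fixes \<nu> l defines "p \<equiv> exp l" and "b \<equiv> base_pow l (\<nu> + 1)" and "h \<equiv> quot_coeff \<nu> l"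
  assumes p: "\<And>k. p ^ Suc k \<noteq> 1" and b: "\<And>k. b * p ^ k \<noteq> 1"
  shows "(1 - b) * h 0 = 1"
    and "(1 - b * p ^ Suc m) * h (Suc m) = b * (\<Sum>i\<le>m. p ^ i * h i * h (m - i))"
proof -
  define H where "H = quot_fps \<nu> l"
  let ?s = "H oo (fps_const p * fps_X)"
  have h: "h m = (- 1) ^ m * H $ m" for m by (simp add: h_def quot_coeff_def H_def)
  have "H = 1 + fps_const b * ?s * (1 - fps_X * H)"
    using quot_fps_riccati[of l \<nu>] p b unfolding H_def p_def b_def by blast
  also have "\<dots> = 1 + fps_const b * (?s - fps_X * (?s * H))"
    by (simp add: algebra_simps)
  finally have nth: "H $ n = (1 + fps_const b * (?s - fps_X * (?s * H))) $ n" for n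
    by (rule arg_cong)
  show "(1 - b) * h 0 = 1" using nth[of 0] by (simp add: h algebra_simps)
  have "H $ Suc m = b * (p ^ Suc m * H $ Suc m - (\<Sum>i\<le>m. p ^ i * H $ i * H $ (m - i)))"
    by (subst nth) (simp, simp add: fps_mult_nth atLeast0AtMost)
  then have "(1 - b * p ^ Suc m) * H $ Suc m = - (b * (\<Sum>i\<le>m. p ^ i * H $ i * H $ (m - i)))"
    by (simp add: algebra_simps)
  moreover have "(\<Sum>i\<le>m. p ^ i * h i * h (m - i)) =
      (- 1) ^ m * (\<Sum>i\<le>m. p ^ i * H $ i * H $ (m - i))"
    unfolding sum_distrib_left
  proof (intro sum.cong refl)
    fix i assume "i \<in> {..m}"
    then have "(- 1 :: complex) ^ m = (- 1) ^ i * (- 1) ^ (m - i)"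
      by (simp flip: power_add)
    then show "p ^ i * h i * h (m - i) = (- 1) ^ m * (p ^ i * H $ i * H $ (m - i))"
      by (simp add: h)
  qed
  moreover have "(1 - b * p ^ Suc m) * h (Suc m) =
      - ((- 1) ^ m * ((1 - b * p ^ Suc m) * H $ Suc m))"
    by (simp add: h)
  ultimately show "(1 - b * p ^ Suc m) * h (Suc m) = b * (\<Sum>i\<le>m. p ^ i * h i * h (m - i))"
    by simp
qed

section \<open>Series in w, and the common recurrence for the bases q and 1/q\<close>

lemma jackson_J1_quotient_nth:
  "jackson_J1_quotient \<nu> l $ n =
     (if odd n then quot_coeff \<nu> l (n div 2) / 2 ^ n else 0)"
proof -
  let ?A = "\<lambda>\<nu>. Abs_fps (jackson_Psi_coeff \<nu> l)" and ?c = "- (fps_X ^ 2) / 4 :: complex fps"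
  \<comment> \<open>Splitting the substitution into a scaling and a squaring allows its coefficients
    to be read off.\<close>
  have c: "?c = (fps_const (- 1 / 4) * fps_X) oo fps_X ^ 2"
    by (rule fps_ext) (simp add: fps_compose_mult_distrib fps_divide_unit fps_numeral_simps
       numeral_fps_const fps_const_inverse)
  have "?A \<nu> $ 0 = 1" by (simp add: jackson_Psi_coeff_def q_poch_def)
  then have "jackson_Psi (\<nu> + 1) l / jackson_Psi \<nu> l = (?A (\<nu> + 1) / ?A \<nu>) oo ?c"
    unfolding jackson_Psi_def by (subst fps_divide_compose) (simp_all add: fps_divide_unit)
  then have "jackson_J1_quotient \<nu> l = fps_X / 2 * (quot_fps \<nu> l oo ?c)"
    by (simp add: jackson_J1_quotient_def quot_fps_def fps_compose_mult_distrib fps_divide_unit mult_ac)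
  also have "quot_fps \<nu> l oo ?c =
      (quot_fps \<nu> l oo (fps_const (- 1 / 4) * fps_X)) oo fps_X ^ 2"
    unfolding c by (subst fps_compose_assoc) simp_all
  also have "fps_X / 2 * \<dots> = fps_const (1 / 2) * (fps_X * \<dots>)"
    by (simp add: fps_divide_unit numeral_fps_const fps_const_inverse mult_ac)
  finally have *: "jackson_J1_quotient \<nu> l $ n = (if n = 0 then 0 else
      1 / 2 * (if even (n - 1) then (- 1 / 4) ^ ((n - 1) div 2) * quot_fps \<nu> l $ ((n - 1) div 2) else 0))"
    by (simp add: fps_nth_compose_X_power)
  show ?thesis
  proof (cases "odd n")
    case True
    then obtain k where "n = Suc (2 * k)" by (auto elim: oddE)
    then show ?thesis unfolding *
      by (simp add: quot_coeff_def power_minus[of "1 / 4"] power_mult power_divide)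
  qed (auto simp: *)
qed

lemma odd_powers_sums:
  fixes F :: "complex fps"
  assumes "\<And>n. F $ n = (if odd n then c (n div 2) / 2 ^ n else 0)"
  shows "(\<lambda>m. fps_const (c m) * (fps_X / 2) ^ (2 * Suc m - 1)) sums F"
  unfolding sums_def
proof (rule tendsto_fpsI)
  fix n
  have X: "(fps_X / 2 :: complex fps) ^ k = fps_const (1 / 2 ^ k) * fps_X ^ k" for k
    by (simp add: fps_divide_unit numeral_fps_const fps_const_inverse power_mult_distrib
        fps_const_power power_divide mult_ac flip: power_inverse)
  have t: "(fps_const (c m) * (fps_X / 2) ^ (2 * Suc m - 1)) $ n =
      (if m = n div 2 then if odd n then c m / 2 ^ n else 0 else 0)" for m
  proof -
    have "n = Suc (2 * m) \<longleftrightarrow> m = n div 2 \<and> odd n" by presburger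
    moreover have "(fps_const (c m) * (fps_X / 2) ^ (2 * Suc m - 1)) $ n =
        (if n = Suc (2 * m) then c m / 2 ^ n else 0)"
      unfolding X by (cases n) (simp_all add: fps_X_power_nth)
    ultimately show ?thesis by auto
  qed
  \<comment> \<open>Convergence of formal power series is coefficientwise: only the summand m = n
    div 2 can contribute to the coefficient of index n.\<close>
  have "(\<Sum>m<M. fps_const (c m) * (fps_X / 2) ^ (2 * Suc m - 1)) $ n = F $ n" if "M > n" for M
    unfolding fps_sum_nth t using that by (subst sum.delta) (auto simp: assms)
  then show "\<forall>\<^sub>F M in sequentially.
      (\<Sum>m<M. fps_const (c m) * (fps_X / 2) ^ (2 * Suc m - 1)) $ n = F $ n"
    by (intro eventually_mono[OF eventually_gt_at_top[of n]])
qed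

text \<open>Both rescaled coefficient sequences solve the same recurrence, whose solution is unique;
  hence one family of numerators serves both bases. The power of 1 - q comes from w = (1 - q)
  z.\<close>

lemma
  fixes \<nu> l defines "q \<equiv> exp l" and "b \<equiv> base_pow l (\<nu> + 1)"
  defines "N \<equiv> \<lambda>m. numerator m q (q_bracket l \<nu>) / D_den (Suc m) \<nu> l"
  assumes q: "\<And>k. q ^ Suc k \<noteq> 1" and b: "\<And>k. b * q ^ k \<noteq> 1"
  shows quot_coeff_eq_numerator:
      "N m * b ^ m = quot_coeff \<nu> l m * (1 - q) ^ (2 * m + 1)"
    and quot_coeff_uminus_eq_numerator:
      "N m * (b ^ Suc m * q ^ m) = - (quot_coeff \<nu> (- l) m * (1 - q) ^ (2 * m + 1))"
proof -
  have q0: "q \<noteq> 0" "1 - q \<noteq> 0" and b0: "b \<noteq> 0"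
    using q[of 0] by (simp_all add: q_def b_def base_pow_def)
  have br: "q_bracket l (of_nat (Suc m) + \<nu>) = (1 - b * q ^ m) / (1 - q)" for m
    by (simp add: q_bracket_def b_def q_def base_pow_add base_pow_of_nat[of l 1, simplified]
        base_pow_of_nat mult_ac)
  have nz: "q_bracket l (of_nat (Suc m) + \<nu>) \<noteq> 0" for m
    using br b[of m] q0 by simp
  have D: "D_den n \<nu> l \<noteq> 0" for n
  proof -
    have "q_bracket l (of_nat k + \<nu>) \<noteq> 0" if "k \<ge> 1" for k
      using nz[of "k - 1"] that by simp
    then show ?thesis by (auto simp: D_den_def)
  qed
  \<comment> \<open>Uniqueness: since 1 - b q^m = (1 - q) [m + 1 + \<nu>], these conditions are
    those of \<open>numerator_eq_D_den_mult\<close> times 1 - q.\<close>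
  have N: "N m = S m"
    if "(1 - b) * S 0 = 1 - q"
       "\<And>m. (1 - b * q ^ Suc m) * S (Suc m) = (1 - q) * (\<Sum>i\<le>m. q ^ i * S i * S (m - i))" for S m
  proof -
    have "numerator m (exp l) (q_bracket l \<nu>) = D_den (Suc m) \<nu> l * S m"
    proof (rule numerator_eq_D_den_mult)
      show "q_bracket l (1 + \<nu>) * S 0 = 1"
        using that(1) br[of 0] q0 by simp
      show "q_bracket l (of_nat (m + 2) + \<nu>) * S (Suc m) = (\<Sum>i\<le>m. exp l ^ i * S i * S (m - i))" for m
      proof -
        have "q_bracket l (of_nat (m + 2) + \<nu>) = (1 - b * q ^ Suc m) / (1 - q)"
          using br[of "Suc m"] by simp
        then show ?thesis using that(2)[of m] q0(2) by (simp only: times_divide_eq_left q_def) simp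
      qed
    qed (use nz q[of 0] in \<open>auto simp: q_def\<close>)
    then show ?thesis using D[of "Suc m"] by (simp add: N_def q_def)
  qed
  let ?h = "quot_coeff \<nu> l"
  have h: "(1 - b) * ?h 0 = 1"
      "(1 - b * q ^ Suc m) * ?h (Suc m) = b * (\<Sum>i\<le>m. q ^ i * ?h i * ?h (m - i))" for m
    using quot_coeff_rec[of l \<nu>] q b unfolding q_def b_def by blast+
  \<comment> \<open>Dividing by b^m removes the factor b from the recurrence. As 2(m+1) + 1 = 1 +
    (2i+1) + (2(m-i)+1), a single factor 1 - q is left over.\<close>
  have "N m = ?h m * (1 - q) ^ (2 * m + 1) / b ^ m"
  proof (rule N)
    fix m
    have "(1 - b * q ^ Suc m) * (?h (Suc m) * (1 - q) ^ (2 * Suc m + 1) / b ^ Suc m) =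
        (b * (\<Sum>i\<le>m. q ^ i * ?h i * ?h (m - i))) * (1 - q) ^ (2 * Suc m + 1) / b ^ Suc m"
      unfolding h(2)[symmetric] by simp
    also have "\<dots> = (1 - q) * ((\<Sum>i\<le>m. q ^ i * ?h i * ?h (m - i)) * ((1 - q) ^ (2 * m + 2) / b ^ m))"
      using b0 by simp
    also have "(\<Sum>i\<le>m. q ^ i * ?h i * ?h (m - i)) * ((1 - q) ^ (2 * m + 2) / b ^ m) =
        (\<Sum>i\<le>m. q ^ i * (?h i * (1 - q) ^ (2 * i + 1) / b ^ i) *
          (?h (m - i) * (1 - q) ^ (2 * (m - i) + 1) / b ^ (m - i)))"
      unfolding sum_distrib_right
    proof (intro sum.cong refl)
      fix i assume "i \<in> {..m}"
      then obtain j where m: "m = i + j" using le_Suc_ex by auto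
      show "q ^ i * ?h i * ?h (m - i) * ((1 - q) ^ (2 * m + 2) / b ^ m) =
          q ^ i * (?h i * (1 - q) ^ (2 * i + 1) / b ^ i) *
          (?h (m - i) * (1 - q) ^ (2 * (m - i) + 1) / b ^ (m - i))"
        unfolding m by (simp add: power_add mult_ac)
    qed
    finally show "(1 - b * q ^ Suc m) * (?h (Suc m) * (1 - q) ^ (2 * Suc m + 1) / b ^ Suc m) =
        (1 - q) * (\<Sum>i\<le>m. q ^ i * (?h i * (1 - q) ^ (2 * i + 1) / b ^ i) *
          (?h (m - i) * (1 - q) ^ (2 * (m - i) + 1) / b ^ (m - i)))" .
  qed (use h(1) in \<open>simp add: mult.assoc[symmetric]\<close>)
  then show "N m * b ^ m = ?h m * (1 - q) ^ (2 * m + 1)" using b0 by simp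
  let ?g = "quot_coeff \<nu> (- l)"
  have inv: "exp (- l) = inverse q" "base_pow (- l) (\<nu> + 1) = inverse b"
    by (simp_all add: q_def b_def base_pow_def exp_minus)
  have "inverse q ^ Suc k \<noteq> 1" "inverse b * inverse q ^ k \<noteq> 1" for k
    using q[of k] b[of k]
    by (metis inverse_1 inverse_inverse_eq power_inverse,
        metis inverse_1 inverse_inverse_eq inverse_mult_distrib power_inverse)
  then have g: "(1 - inverse b) * ?g 0 = 1"
      "(1 - inverse b * inverse q ^ Suc m) * ?g (Suc m) =
        inverse b * (\<Sum>i\<le>m. inverse q ^ i * ?g i * ?g (m - i))" for m
    using quot_coeff_rec[of "- l" \<nu>] unfolding inv by blast+
  have "N m = - (?g m * (1 - q) ^ (2 * m + 1)) / (b ^ Suc m * q ^ m)"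
  proof (rule N)
    show "(1 - b) * (- (?g 0 * (1 - q) ^ (2 * 0 + 1)) / (b ^ Suc 0 * q ^ 0)) = 1 - q"
      using g(1) b0 by (simp add: field_simps)
    fix m
    \<comment> \<open>Multiplication by - b q^(m+1) turns the factor for the inverse base into the
      one for q.\<close>
    have "(1 - b * q ^ Suc m) * ?g (Suc m) =
        - (b * q ^ Suc m) * ((1 - inverse b * inverse q ^ Suc m) * ?g (Suc m))"
      using b0 q0 by (simp add: field_simps)
    also have "\<dots> = - (q ^ Suc m * (\<Sum>i\<le>m. inverse q ^ i * ?g i * ?g (m - i)))"
      unfolding g(2) using b0 by simp
    finally have "(1 - b * q ^ Suc m) * (- (?g (Suc m) * (1 - q) ^ (2 * Suc m + 1)) / (b ^ Suc (Suc m) * q ^ Suc m)) =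
        (q ^ Suc m * (\<Sum>i\<le>m. inverse q ^ i * ?g i * ?g (m - i))) * (1 - q) ^ (2 * Suc m + 1) / (b ^ Suc (Suc m) * q ^ Suc m)"
      by (simp only: times_divide_eq_right mult_minus_right mult.assoc[symmetric]) simp
    also have "\<dots> = (1 - q) * ((\<Sum>i\<le>m. inverse q ^ i * ?g i * ?g (m - i)) * ((1 - q) ^ (2 * m + 2) / b ^ (m + 2)))"
      using q0 by simp
    \<comment> \<open>Exchanging i and m - i makes the weight q^(i-m) = q^i / (q^i q^(m-i)): the
      required q^i, with the denominators split between the two factors.\<close>
    also have "(\<Sum>i\<le>m. inverse q ^ i * ?g i * ?g (m - i)) =
        (\<Sum>i\<le>m. inverse q ^ (m - i) * ?g i * ?g (m - i))"
      by (rule sum.reindex_bij_witness[of _ "\<lambda>i. m - i" "\<lambda>i. m - i"]) auto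
    also have "(\<Sum>i\<le>m. inverse q ^ (m - i) * ?g i * ?g (m - i)) * ((1 - q) ^ (2 * m + 2) / b ^ (m + 2)) =
        (\<Sum>i\<le>m. q ^ i * (- (?g i * (1 - q) ^ (2 * i + 1)) / (b ^ Suc i * q ^ i)) *
          (- (?g (m - i) * (1 - q) ^ (2 * (m - i) + 1)) / (b ^ Suc (m - i) * q ^ (m - i))))"
      unfolding sum_distrib_right
    proof (intro sum.cong refl)
      fix i assume "i \<in> {..m}"
      then obtain j where m: "m = i + j" using le_Suc_ex by auto
      show "inverse q ^ (m - i) * ?g i * ?g (m - i) * ((1 - q) ^ (2 * m + 2) / b ^ (m + 2)) =
        q ^ i * (- (?g i * (1 - q) ^ (2 * i + 1)) / (b ^ Suc i * q ^ i)) *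
          (- (?g (m - i) * (1 - q) ^ (2 * (m - i) + 1)) / (b ^ Suc (m - i) * q ^ (m - i)))"
        using q0 b0 unfolding m by (simp add: power_add power_inverse divide_inverse mult_ac)
    qed
    finally show "(1 - b * q ^ Suc m) * (- (?g (Suc m) * (1 - q) ^ (2 * Suc m + 1)) / (b ^ Suc (Suc m) * q ^ Suc m)) =
        (1 - q) * (\<Sum>i\<le>m. q ^ i * (- (?g i * (1 - q) ^ (2 * i + 1)) / (b ^ Suc i * q ^ i)) *
          (- (?g (m - i) * (1 - q) ^ (2 * (m - i) + 1)) / (b ^ Suc (m - i) * q ^ (m - i))))" .
  qed
  then show "N m * (b ^ Suc m * q ^ m) = - (?g m * (1 - q) ^ (2 * m + 1))" using b0 q0 by simp
qed

theorem theorem3p4: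
  fixes \<nu> :: complex
  assumes "\<forall>k::nat. k \<ge> 1 \<longrightarrow> \<nu> \<noteq> - of_nat k"
  shows "\<exists>N :: nat \<Rightarrow> (nat \<times> nat \<times> nat \<Rightarrow>\<^sub>0 nat). \<forall>q l :: complex.
    exp l = q \<and>
    (\<forall>k::nat. k \<ge> 1 \<longrightarrow> q ^ k \<noteq> 1) \<and>
    (\<forall>k::nat. k \<ge> 1 \<longrightarrow> base_pow l (\<nu> + of_nat k) \<noteq> 1) \<longrightarrow>
    (\<lambda>m. let n = Suc m in
        fps_const (eval_poly3 (N n) q (base_pow l \<nu>) (q_bracket l \<nu>) / D_den n \<nu> l *
          base_pow l ((\<nu> + 1) * (of_nat n - 1))) * (fps_X / 2) ^ (2 * n - 1))
      sums (jackson_J1_quotient \<nu> l oo (fps_const (1 - q) * fps_X)) \<and>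
    (\<lambda>m. let n = Suc m in
        fps_const (eval_poly3 (N n) q (base_pow l \<nu>) (q_bracket l \<nu>) / D_den n \<nu> l *
          base_pow l ((\<nu> + 2) * of_nat n - 1)) * (fps_X / 2) ^ (2 * n - 1))
      sums (- (jackson_J1_quotient \<nu> (- l) oo (fps_const (1 - q) * fps_X)))"
proof -
  have "\<forall>m. \<exists>P. \<forall>x y z. eval_poly3 P x y z = numerator m x z"
    using natpoly3_numerator unfolding natpoly3_def by blast
  then obtain P where P: "\<And>m x y z. eval_poly3 (P m) x y z = numerator m x z"
    by metis
  show ?thesis
  \<comment> \<open>The witness undoes the index shift of \<open>numerator\<close> and is fixed
    before q and its logarithm are chosen.\<close>
  proof (intro exI[of _ "\<lambda>n. P (n - 1)"] allI impI, elim conjE, unfold Let_def, rule conjI)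
    fix q l :: complex
    assume l: "exp l = q"
      and q: "\<forall>k::nat. k \<ge> 1 \<longrightarrow> q ^ k \<noteq> 1"
      and b: "\<forall>k::nat. k \<ge> 1 \<longrightarrow> base_pow l (\<nu> + of_nat k) \<noteq> 1"
    let ?b = "base_pow l (\<nu> + 1)"
    have q': "exp l ^ Suc k \<noteq> 1" for k using q l by (metis le_add1 plus_1_eq_Suc)
    have b': "?b * exp l ^ k \<noteq> 1" for k
    proof -
      have "?b * exp l ^ k = base_pow l (\<nu> + of_nat (Suc k))"
        unfolding base_pow_of_nat[symmetric] base_pow_add[symmetric] by (simp add: add_ac)
      then show ?thesis using b by (metis le_add1 plus_1_eq_Suc)
    qed
    have e1: "base_pow l ((\<nu> + 1) * (of_nat (Suc m) - 1)) = ?b ^ m" for m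
      by (simp add: base_pow_mult_of_nat)
    have e2: "base_pow l ((\<nu> + 2) * of_nat (Suc m) - 1) = ?b ^ Suc m * exp l ^ m" for m
    proof -
      have "(\<nu> + 2) * of_nat (Suc m) - 1 = (\<nu> + 1) * of_nat (Suc m) + of_nat m"
        by (simp add: algebra_simps)
      then show ?thesis by (simp only: base_pow_add base_pow_mult_of_nat base_pow_of_nat)
    qed
    show "(\<lambda>m. fps_const (eval_poly3 (P (Suc m - 1)) q (base_pow l \<nu>) (q_bracket l \<nu>) /
          D_den (Suc m) \<nu> l * base_pow l ((\<nu> + 1) * (of_nat (Suc m) - 1))) *
          (fps_X / 2) ^ (2 * Suc m - 1))
        sums (jackson_J1_quotient \<nu> l oo (fps_const (1 - q) * fps_X))"
      unfolding P e1 l[symmetric] diff_Suc_1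
      by (intro odd_powers_sums, subst quot_coeff_eq_numerator)
         (use q' b' in \<open>simp_all add: jackson_J1_quotient_nth\<close>)
    show "(\<lambda>m. fps_const (eval_poly3 (P (Suc m - 1)) q (base_pow l \<nu>) (q_bracket l \<nu>) /
          D_den (Suc m) \<nu> l * base_pow l ((\<nu> + 2) * of_nat (Suc m) - 1)) *
          (fps_X / 2) ^ (2 * Suc m - 1))
        sums (- (jackson_J1_quotient \<nu> (- l) oo (fps_const (1 - q) * fps_X)))"
      unfolding P e2 l[symmetric] diff_Suc_1
      by (intro odd_powers_sums, subst quot_coeff_uminus_eq_numerator)
         (use q' b' in \<open>simp_all add: jackson_J1_quotient_nth\<close>)
  qed
qed

end
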